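(* Let $N\ge 2$, $h=1/N$, and let $\mathfrak{u}\in l^2_{h,0}$ with Hermitian derivative $\mathfrak{u}_x\in l^2_{h,0}$ satisfy $$\delta_x^4\mathfrak{u}=\mathfrak{f}.$$ If $\mathfrak{f}_j\ge 0$ for $0\le j\le N$, then also $\mathfrak{u}_j\ge 0$ for $0\le j\le N$.
   Context: The grid on $[0,1]$ is $x_j=jh$, $0\le j\le N$. A grid function is a vector $\mathfrak{v}=(\mathfrak{v}_j)_{j=0}^N$; $l^2_{h,0}$ is the space of grid functions with $\mathfrak{v}_0=\mathfrak{v}_N=0$. Finite differences, for $1\le j\le N-1$: $(\delta_x\mathfrak{v})_j=\frac{\mathfrak{v}_{j+1}-\mathfrak{v}_{j-1}}{2h}$ and $(\delta_x^2\mathfrak{v})_j=\frac{\mathfrak{v}_{j+1}-2\mathfrak{v}_j+\mathfrak{v}_{j-1}}{h^2}$. Hermitian derivative: for $\mathfrak{u}\in l^2_{h,0}$, $\mathfrak{u}_x$ is the unique element of $l^2_{h,0}$ with $\tfrac16(\mathfrak{u}_x)_{j-1}+\tfrac23(\mathfrak{u}_x)_j+\tfrac16(\mathfrak{u}_x)_{j+1}=(\delta_x\mathfrak{u})_j$ for $1\le j\le N-1$. Discrete biharmonic operator: $$(\delta_x^4\mathfrak{u})_j=\frac{12}{h^2}\big[(\delta_x\mathfrak{u}_x)_j-(\delta_x^2\mathfrak{u})_j\big],\qquad 1\le j\le N-1,$$ and $\delta_x^4\mathfrak{u}$ is regarded as an element of $l^2_{h,0}$ (endpoint values $0$); the equation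 $\delta_x^4\mathfrak{u}=\mathfrak{f}$ is an equation at the interior nodes $1\le j\le N-1$. *)

theory Defs
  imports Complex_Main
begin

text \<open>
  A grid function \<open>(v\<^sub>0, \<dots>, v\<^sub>N)\<close> is represented by a function on \<open>nat\<close>, of which only the
  values at \<open>0, \<dots>, N\<close> carry information.  Elements of \<open>l2h0 N\<close> are additionally normalised to
  vanish beyond \<open>N\<close>, so that they correspond one-to-one to the vectors with
  \<open>v\<^sub>0 = v\<^sub>N = 0\<close>; this makes the Hermitian derivative unique as a function on \<open>nat\<close>.
\<close>

definition l2h0 :: "nat \<Rightarrow> (nat \<Rightarrow> real) set" where
  "l2h0 N = {v. v 0 = 0 \<and> v N = 0 \<and> (\<forall>j>N. v j = 0)}"

text \<open>
  The difference quotients are meant for interior nodes \<open>1 \<le> j \<le> N - 1\<close> only: at \<open>j = 0\<close> the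
  index \<open>j - 1\<close> is truncated.  All uses below respect this.
\<close>

definition diff1 :: "real \<Rightarrow> (nat \<Rightarrow> real) \<Rightarrow> nat \<Rightarrow> real" where
  "diff1 h v j = (v (j + 1) - v (j - 1)) / (2 * h)"

definition diff2 :: "real \<Rightarrow> (nat \<Rightarrow> real) \<Rightarrow> nat \<Rightarrow> real" where
  "diff2 h v j = (v (j + 1) - 2 * v j + v (j - 1)) / h\<^sup>2"

definition is_hermitian_deriv :: "nat \<Rightarrow> real \<Rightarrow> (nat \<Rightarrow> real) \<Rightarrow> (nat \<Rightarrow> real) \<Rightarrow> bool" where
  "is_hermitian_deriv N h u ux \<longleftrightarrow> ux \<in> l2h0 N \<and>
     (\<forall>j\<in>{1..N - 1}. 1/6 * ux (j - 1) + 2/3 * ux j + 1/6 * ux (j + 1) = diff1 h u j)"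

definition hermitian_deriv :: "nat \<Rightarrow> real \<Rightarrow> (nat \<Rightarrow> real) \<Rightarrow> nat \<Rightarrow> real" where
  "hermitian_deriv N h u = (THE ux. is_hermitian_deriv N h u ux)"

definition biharmonic :: "nat \<Rightarrow> real \<Rightarrow> (nat \<Rightarrow> real) \<Rightarrow> nat \<Rightarrow> real" where
  "biharmonic N h u j =
     (if j \<in> {1..N - 1}
      then 12 / h\<^sup>2 * (diff1 h (hermitian_deriv N h u) j - diff2 h u j)
      else 0)"

text \<open>
  The tridiagonal system defining the Hermitian derivative is uniquely solvable, so the definite
  description above is well defined.  The solution is found by shooting: \<open>shoot r t\<close> solves the
  recurrence with initial values \<open>0\<close> and \<open>t\<close>, and depends on \<open>t\<close> affinely.
\<close>

fun shoot :: "(nat \<Rightarrow> real) \<Rightarrow> real \<Rightarrow> nat \<Rightarrow> real" where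
  "shoot r t 0 = 0"
| "shoot r t (Suc 0) = t"
| "shoot r t (Suc (Suc n)) = 6 * r (Suc n) - 4 * shoot r t (Suc n) - shoot r t n"

lemma shoot_affine: "shoot r t n = shoot r 0 n + t * shoot (\<lambda>_. 0) 1 n"
  by (induction r t n rule: shoot.induct) (simp_all add: algebra_simps)

lemma shoot_grows:
  "\<bar>shoot (\<lambda>_. 0) 1 n\<bar> < \<bar>shoot (\<lambda>_. 0) 1 (Suc n)\<bar>"
proof (induction n)
  case (Suc n)
  then show ?case by (simp add: abs_if split: if_splits)
qed simp

lemma shoot_nonzero: "0 < n \<Longrightarrow> shoot (\<lambda>_. 0) 1 n \<noteq> 0"
  using shoot_grows[of "n - 1"] by (cases n) auto

lemma shoot_unique:
  assumes "v 0 = 0"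
    and eq: "\<forall>j\<in>{1..N - 1}. 1/6 * v (j - 1) + 2/3 * v j + 1/6 * v (j + 1) = r j"
  shows "n \<le> N \<Longrightarrow> v n = shoot r (v 1) n"
proof (induction n rule: less_induct)
  case (less n)
  consider "n = 0" | "n = Suc 0" | m where "n = Suc (Suc m)"
    by (metis not0_implies_Suc)
  then show ?case
  proof cases
    case 3
    have "Suc m \<in> {1..N - 1}" using less.prems 3 by auto
    from bspec[OF eq this]
    have "v n = 6 * r (Suc m) - 4 * v (Suc m) - v m" using 3 by simp
    moreover have "v (Suc m) = shoot r (v 1) (Suc m)" "v m = shoot r (v 1) m"
      using less.IH[of "Suc m"] less.IH[of m] less.prems 3 by linarith+
    ultimately show ?thesis using 3 by (simp only: shoot.simps)
  qed (simp_all add: \<open>v 0 = 0\<close>)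
qed

lemma ex1_hermitian_deriv:
  assumes "1 \<le> N"
  shows "\<exists>!ux. is_hermitian_deriv N h u ux"
proof -
  let ?r = "diff1 h u"
  let ?q = "shoot (\<lambda>_. 0) 1 N"
  have q: "?q \<noteq> 0" using assms by (intro shoot_nonzero) simp
  define t where "t = - shoot ?r 0 N / ?q"
  have end0: "shoot ?r s N = 0 \<longleftrightarrow> s = t" for s
    using q unfolding t_def by (subst shoot_affine) (auto simp: field_simps)
  define w where "w = (\<lambda>j. if j \<le> N then shoot ?r t j else 0)"
  have "is_hermitian_deriv N h u w"
    unfolding is_hermitian_deriv_def
  proof (intro conjI ballI)
    show "w \<in> l2h0 N" using end0[of t] by (simp add: l2h0_def w_def)
    fix j assume j: "j \<in> {1..N - 1}"
    then obtain m where m: "j = Suc m" by (cases j) auto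
    have "m \<le> N" "Suc m \<le> N" "Suc (Suc m) \<le> N" using j m by auto
    then show "1/6 * w (j - 1) + 2/3 * w j + 1/6 * w (j + 1) = ?r j"
      by (simp add: w_def m) (simp add: field_simps)
  qed
  moreover have "v = w" if v: "is_hermitian_deriv N h u v" for v
  proof
    fix n
    have v0: "v 0 = 0" "v N = 0" "\<And>j. N < j \<Longrightarrow> v j = 0"
      using v by (auto simp: is_hermitian_deriv_def l2h0_def)
    have eq: "n \<le> N \<Longrightarrow> v n = shoot ?r (v 1) n" for n
      using shoot_unique[of v N ?r n] v0(1) v by (simp add: is_hermitian_deriv_def)
    have "v 1 = t" using eq[of N] v0(2) end0[of "v 1"] by simp
    then show "v n = w n" using eq[of n] v0(3)[of n] by (cases "n \<le> N") (simp_all only: w_def, simp_all)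
  qed
  ultimately show ?thesis by blast
qed

lemma is_hermitian_deriv_hermitian_deriv:
  assumes "1 \<le> N"
  shows "is_hermitian_deriv N h u (hermitian_deriv N h u)"
  unfolding hermitian_deriv_def by (rule theI'[OF ex1_hermitian_deriv[OF assms]])

end

theory Submission
  imports Defs
begin

text \<open>
  Nodal values \<open>u\<^sub>j\<close> together with slopes \<open>p\<^sub>j\<close> determine a \<open>C\<^sup>1\<close> piecewise cubic \<open>S\<close>.  The
  equation defining the Hermitian derivative says exactly that \<open>S''\<close> is continuous at the
  interior nodes, so the Hermitian derivative consists of the slopes of the cubic spline
  interpolant of \<open>u\<close> with zero slope at both ends.  Moreover \<open>h (\<delta>\<^sub>x\<^sup>4 u)\<^sub>j\<close> is the jump of
  \<open>S'''\<close> at the \<open>j\<close>-th node.  Hence \<open>\<delta>\<^sub>x\<^sup>4 u = f\<close> means that \<open>S\<close> is the deflection of a beam,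
  clamped at both ends, under the point loads \<open>h f\<^sub>j\<close>, and
  \<open>u\<^sub>i = h (\<Sum>j. G(x\<^sub>i, x\<^sub>j) f\<^sub>j)\<close> with the Green function \<open>G\<close> of the clamped beam.  That function
  is explicit and nonnegative.

  To obtain the representation formula without solving the equation, note that for two splines
  \<open>S\<close> and \<open>R\<close> the expression \<open>R S''' - R' S'' + R'' S' - R''' S\<close> is constant on each mesh
  interval and changes at a node by \<open>R [S'''] - S [R''']\<close>, where the brackets denote jumps.  It
  vanishes at both clamped ends, so summation over the nodes gives
  \<open>\<Sum> R [S'''] = \<Sum> S [R''']\<close> (lemma \<open>spline_reciprocity\<close>).  Taking for \<open>R\<close> the Green function of
  the \<open>i\<close>-th node, whose third derivative jumps by \<open>1\<close> there and nowhere else, leaves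
  \<open>u\<^sub>i\<close> on the right-hand side.

  All splines below live on the mesh \<open>0, 1, 2, \<dots>\<close> of width one; slopes are rescaled by \<open>h\<close>.
\<close>

section \<open>Cubic splines on a uniform mesh\<close>

text \<open>Continuity of the second derivative at the node \<open>j + 1\<close>.\<close>

definition spline_at :: "(nat \<Rightarrow> real) \<Rightarrow> (nat \<Rightarrow> real) \<Rightarrow> nat \<Rightarrow> bool" where
  "spline_at u p j \<longleftrightarrow> p j + 4 * p (Suc j) + p (Suc (Suc j)) = 3 * (u (Suc (Suc j)) - u j)"

text \<open>The second derivative at \<open>j\<close>, from the right, of the cubic on \<open>[j, j + 1]\<close>.\<close>

definition second_deriv :: "(nat \<Rightarrow> real) \<Rightarrow> (nat \<Rightarrow> real) \<Rightarrow> nat \<Rightarrow> real" where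
  "second_deriv u p j = 6 * (u (Suc j) - u j) - 4 * p j - 2 * p (Suc j)"

text \<open>The constant third derivative of the cubic on \<open>[j, j + 1]\<close>.\<close>

definition third_deriv :: "(nat \<Rightarrow> real) \<Rightarrow> (nat \<Rightarrow> real) \<Rightarrow> nat \<Rightarrow> real" where
  "third_deriv u p j = 6 * (p j + p (Suc j)) - 12 * (u (Suc j) - u j)"

definition third_deriv_jump :: "(nat \<Rightarrow> real) \<Rightarrow> (nat \<Rightarrow> real) \<Rightarrow> nat \<Rightarrow> real" where
  "third_deriv_jump u p j = third_deriv u p (Suc j) - third_deriv u p j"

text \<open>
  The expression \<open>R S''' - R' S'' + R'' S' - R''' S\<close> at \<open>j\<close>, from the right, where \<open>S\<close> has the
  data \<open>u, p\<close> and \<open>R\<close> the data \<open>v, q\<close>.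
\<close>

definition bilinear_concomitant ::
  "(nat \<Rightarrow> real) \<Rightarrow> (nat \<Rightarrow> real) \<Rightarrow> (nat \<Rightarrow> real) \<Rightarrow> (nat \<Rightarrow> real) \<Rightarrow> nat \<Rightarrow> real" where
  "bilinear_concomitant u p v q j =
     v j * third_deriv u p j - q j * second_deriv u p j
     + second_deriv v q j * p j - third_deriv v q j * u j"

text \<open>
  Within a mesh interval the concomitant of two cubics does not vary, so it may be evaluated at
  the right end, where all terms except those with the third derivative agree with their values
  from the other side of the node.
\<close>

lemma bilinear_concomitant_step:
  assumes "spline_at u p j" and "spline_at v q j"
  shows "bilinear_concomitant u p v q (Suc j) - bilinear_concomitant u p v q j =
         v (Suc j) * third_deriv_jump u p j - u (Suc j) * third_deriv_jump v q j"
proof -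
  have slopes: "p (Suc (Suc j)) = 3 * (u (Suc (Suc j)) - u j) - p j - 4 * p (Suc j)"
    "q (Suc (Suc j)) = 3 * (v (Suc (Suc j)) - v j) - q j - 4 * q (Suc j)"
    using assms unfolding spline_at_def by linarith+
  show ?thesis
    unfolding bilinear_concomitant_def second_deriv_def third_deriv_def third_deriv_jump_def slopes
    by (simp add: algebra_simps)
qed

text \<open>This is Betti's reciprocity: the beam operator with clamped ends is symmetric.\<close>

lemma spline_reciprocity:
  assumes spline: "\<And>j. j < n \<Longrightarrow> spline_at u p j" "\<And>j. j < n \<Longrightarrow> spline_at v q j"
    and left: "u 0 = 0" "p 0 = 0" "v 0 = 0" "q 0 = 0"
    and right: "u (Suc n) = 0" "p (Suc n) = 0" "v (Suc n) = 0" "q (Suc n) = 0"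
  shows "(\<Sum>j<n. v (Suc j) * third_deriv_jump u p j) =
         (\<Sum>j<n. u (Suc j) * third_deriv_jump v q j)"
proof -
  let ?W = "bilinear_concomitant u p v q"
  have "(\<Sum>j<n. v (Suc j) * third_deriv_jump u p j) -
        (\<Sum>j<n. u (Suc j) * third_deriv_jump v q j) = (\<Sum>j<n. ?W (Suc j) - ?W j)"
    using spline by (simp add: bilinear_concomitant_step flip: sum_subtractf)
  also have "\<dots> = ?W n - ?W 0"
    by (rule sum_lessThan_telescope)
  also have "?W 0 = 0"
    by (simp add: bilinear_concomitant_def left)
  also have "?W n = 0"
    by (simp add: bilinear_concomitant_def second_deriv_def third_deriv_def right algebra_simps)
  finally show ?thesis by simp
qed

section \<open>The Green function of the clamped beam\<close>

text \<open>
  The load sits at \<open>i\<close> and the beam has length \<open>N\<close>.  Left of the load the deflection is a cubic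
  with a double zero at \<open>0\<close>; to its right a truncated power \<open>(x - i)\<^sup>3 / 6\<close> is added, which has
  unit jump in the third derivative.  The coefficients of the cubic are those that produce the
  double zero at \<open>N\<close>.
\<close>

definition green :: "real \<Rightarrow> nat \<Rightarrow> nat \<Rightarrow> real" where
  "green N i j = (N - real i)\<^sup>2 * (real j)\<^sup>2 * (3 * N * real i - (N + 2 * real i) * real j) / (6 * N ^ 3)
     + (if i \<le> j then (real j - real i) ^ 3 / 6 else 0)"

definition green_slope :: "real \<Rightarrow> nat \<Rightarrow> nat \<Rightarrow> real" where
  "green_slope N i j = (N - real i)\<^sup>2 * real j * (2 * N * real i - (N + 2 * real i) * real j) / (2 * N ^ 3)
     + (if i \<le> j then (real j - real i)\<^sup>2 / 2 else 0)"

lemma green_left_end: "0 < i \<Longrightarrow> green N i 0 = 0" "0 < i \<Longrightarrow> green_slope N i 0 = 0"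
  by (simp_all add: green_def green_slope_def)

lemma green_right_end:
  assumes "i \<le> N" "0 < N"
  shows "green (real N) i N = 0" and "green_slope (real N) i N = 0"
  using assms
  by (simp_all add: green_def green_slope_def field_simps power2_eq_square power3_eq_cube)

text \<open>
  The two forms of the Green function, one on each side of the load, are interchanged by
  exchanging load and observation point.  Each is nonnegative on its side once the last factor is
  grouped as a sum of two nonnegative terms.
\<close>

lemma green_nonneg:
  assumes "i \<le> N" "j \<le> N" "0 < N"
  shows "0 \<le> green (real N) i j"
proof (cases "i \<le> j")
  case True
  have "green (real N) i j = (real i)\<^sup>2 * (real N - real j)\<^sup>2 *
          (2 * real j * (real N - real i) + real N * (real j - real i)) / (6 * real N ^ 3)"
    using True assms
    by (simp add: green_def field_simps power2_eq_square power3_eq_cube)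
  then show ?thesis using True assms by simp
next
  case False
  have "green (real N) i j = (real j)\<^sup>2 * (real N - real i)\<^sup>2 *
          (2 * real i * (real N - real j) + real N * (real i - real j)) / (6 * real N ^ 3)"
    using False by (simp add: green_def algebra_simps)
  then show ?thesis using False assms by simp
qed

text \<open>
  A truncated power is a single cubic around every node except \<open>i\<close>, whence the case distinction
  on the position of the node \<open>j + 1\<close> relative to the load.
\<close>

lemma green_spline:
  assumes "0 < N"
  shows "spline_at (green N i) (green_slope N i) j"
proof -
  consider "i \<le> j" | "i = Suc j" | "Suc (Suc j) \<le> i" by linarith
  then show ?thesis
    using assms
    by cases (auto simp: spline_at_def green_def green_slope_def field_simps
      power2_eq_square power3_eq_cube not_less_eq_eq)
qed

lemma green_jump:
  assumes "0 < N"
  shows "third_deriv_jump (green N i) (green_slope N i) j = (if i = Suc j then 1 else 0)"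
proof -
  consider "i \<le> j" | "i = Suc j" | "Suc (Suc j) \<le> i" by linarith
  then show ?thesis
    using assms
    by cases (auto simp: third_deriv_jump_def third_deriv_def green_def green_slope_def
      field_simps power2_eq_square power3_eq_cube not_less_eq_eq)
qed

section \<open>Positivity\<close>

lemma clamped_spline_nonneg:
  assumes spline: "\<And>j. j < n \<Longrightarrow> spline_at u p j"
    and ends: "u 0 = 0" "p 0 = 0" "u (Suc n) = 0" "p (Suc n) = 0"
    and load: "\<And>j. j < n \<Longrightarrow> 0 \<le> third_deriv_jump u p j"
    and "k < n"
  shows "0 \<le> u (Suc k)"
proof -
  let ?v = "green (real (Suc n)) (Suc k)" and ?q = "green_slope (real (Suc n)) (Suc k)"
  have "(\<Sum>j<n. ?v (Suc j) * third_deriv_jump u p j) = (\<Sum>j<n. u (Suc j) * third_deriv_jump ?v ?q j)"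
    using \<open>k < n\<close>
    by (intro spline_reciprocity spline green_spline ends green_left_end green_right_end) auto
  also have "\<dots> = (\<Sum>j<n. if k = j then u (Suc j) else 0)"
    by (intro sum.cong refl) (subst green_jump; simp)
  also have "\<dots> = u (Suc k)"
    using \<open>k < n\<close> by simp
  finally have "u (Suc k) = (\<Sum>j<n. ?v (Suc j) * third_deriv_jump u p j)" ..
  also have "\<dots> \<ge> 0"
    using \<open>k < n\<close> by (intro sum_nonneg mult_nonneg_nonneg load green_nonneg) auto
  finally show ?thesis .
qed

lemma hermitian_deriv_spline:
  assumes "is_hermitian_deriv (Suc n) h u ux" "j < n" "h \<noteq> 0"
  shows "spline_at u (\<lambda>k. h * ux k) j"
proof -
  have "Suc j \<in> {1..Suc n - 1}" using assms by auto
  moreover have "\<forall>m\<in>{1..Suc n - 1}. 1/6 * ux (m - 1) + 2/3 * ux m + 1/6 * ux (m + 1) = diff1 h u m"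
    using assms(1) by (simp add: is_hermitian_deriv_def)
  ultimately have "1/6 * ux j + 2/3 * ux (Suc j) + 1/6 * ux (Suc (Suc j)) = diff1 h u (Suc j)"
    by (metis Suc_eq_plus1 diff_Suc_1)
  with \<open>h \<noteq> 0\<close> show ?thesis
    by (simp add: spline_at_def diff1_def field_simps)
qed

text \<open>
  Passing to the mesh of width one multiplies the third derivative by \<open>h\<^sup>3\<close>, so the jump
  \<open>h (\<delta>\<^sub>x\<^sup>4 u)\<^sub>j\<close> acquires the factor \<open>h\<^sup>4\<close>.
\<close>

lemma biharmonic_eq_jump:
  assumes "j < n" "h \<noteq> 0"
  shows "third_deriv_jump u (\<lambda>k. h * hermitian_deriv (Suc n) h u k) j =
         h ^ 4 * biharmonic (Suc n) h u (Suc j)"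
  using assms
  by (simp add: third_deriv_jump_def third_deriv_def biharmonic_def diff1_def diff2_def
    field_simps power2_eq_square power4_eq_xxxx)

theorem proposition5p3:
  fixes N :: nat and h :: real and u f :: "nat \<Rightarrow> real"
  assumes "N \<ge> 2"
    and "h = 1 / real N"
    and "u \<in> l2h0 N"
    and "\<forall>j\<in>{1..N - 1}. biharmonic N h u j = f j"
    and "\<forall>j\<in>{0..N}. f j \<ge> 0"
  shows "\<forall>j\<in>{0..N}. u j \<ge> 0"
proof
  fix j assume j: "j \<in> {0..N}"
  obtain n where N: "N = Suc n" using assms(1) by (cases N) auto
  have h: "h \<noteq> 0" using assms(1,2) by simp
  let ?ux = "hermitian_deriv N h u"
  have ux: "is_hermitian_deriv N h u ?ux"
    using assms(1) by (intro is_hermitian_deriv_hermitian_deriv) simp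
  have u_ends: "u 0 = 0" "u N = 0" using assms(3) by (auto simp: l2h0_def)
  have ux_ends: "?ux 0 = 0" "?ux N = 0"
    using ux by (auto simp: is_hermitian_deriv_def l2h0_def)
  have interior: "0 \<le> u (Suc k)" if "k < n" for k
  proof (rule clamped_spline_nonneg[where p = "\<lambda>k. h * ?ux k" and n = n])
    show "spline_at u (\<lambda>k. h * ?ux k) m" if "m < n" for m
      using hermitian_deriv_spline ux that h unfolding N by blast
    show "0 \<le> third_deriv_jump u (\<lambda>k. h * ?ux k) m" if "m < n" for m
    proof -
      have "biharmonic N h u (Suc m) = f (Suc m)" "0 \<le> f (Suc m)"
        using assms(4,5) that by (auto simp: N)
      then show ?thesis
        using biharmonic_eq_jump[OF that h, of u] by (simp add: N)
    qed
  qed (use that u_ends ux_ends N in auto)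
  show "0 \<le> u j"
  proof (cases j)
    case (Suc k)
    then show ?thesis
      using interior[of k] u_ends j N by (cases "k < n") (auto simp: not_less le_Suc_eq)
  qed (simp add: u_ends)
qed

end
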